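(* Let $\Bbbk=\mathbb{R}$ or $\mathbb{C}$, let $\rho\subset\{1,\ldots,n\}$ with $\sharp\rho=\ell$, and let $A\in\mathcal{V}_\rho\subset\Bbbk^{m\times n}$. If the chordal, Grassmann, or Procrustes distance is selected on the Grassmannians, and the Euclidean (Frobenius) distance on $\Bbbk^{m\times n}$ and $\Bbbk^{n\times m}$, then the following equality of condition numbers of right and left singular subspaces holds: $$\kappa[\mathcal{R}_\rho^{\Bbbk}](A)=\kappa[\mathcal{L}_\rho^{\Bbbk}](A^H).$$ Here $\mathcal{R}_\rho^{\Bbbk}$ is the map taking $m\times n$ matrices to their right singular subspace selected by $\rho$, and $\mathcal{L}_\rho^{\Bbbk}$ is the map taking $n\times m$ matrices to their left singular subspace selected by $\rho$.
   Context: Condition number: for a map $f:X\to Y$ between metric spaces $(X,d_X)$, $(Y,d_Y)$ and $x\in X$, $$\kappa[f](x):=\lim_{\epsilon\to0}\ \sup_{x'\in X,\ 0<d_X(x,x')\le\epsilon}\frac{d_Y(f(x),f(x'))}{d_X(x,x')}.$$ Singular subspaces: a full SVD of a $p\times q$ matrix $B$ over $\Bbbk$ of rank $r$ is $B=U\widehat\Sigma V^H$ with $U\in\Bbbk^{p\times p}$, $V\in\Bbbk^{q\times q}$ unitary (orthogonal if $\Bbbk=\mathbb{R}$) and $\widehat\Sigma$ the $p\times q$ matrix whose upper left $r\times r$ block is $\mathrm{diag}(\sigma_1,\ldots,\sigma_r)$, $\sigma_1\ge\cdots\ge\sigma_r>0$, and which is zero elsewhere. For a nonzero singular value $\sigma'$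 of $B$, $\mathrm{U}_{\sigma'}\subset\Bbbk^p$ and $\mathrm{V}_{\sigma'}\subset\Bbbk^q$ are the spans of the columns of $U$, respectively $V$, corresponding to $\sigma'$, i.e., the eigenspaces of $BB^H$, respectively $B^HB$, with eigenvalue $\sigma'^2$; $\mathrm{U}_0$ is the cokernel (kernel of $BB^H$) and $\mathrm{V}_0$ the kernel of $B$. A left (respectively right) singular subspace of $B$ is a direct sum of the spaces $\mathrm{U}_{\sigma'}$ (respectively $\mathrm{V}_{\sigma'}$) over a subset of the set consisting of the distinct nonzero singular values and $0$. For $\pi\subset\{1,\ldots,p\}$ let $\mathrm{U}_\pi$ be the span of the columns of $U$ with index in $\pi$, $\mathcal{U}_\pi=\{B\in\Bbbk^{p\times q}\mid\mathrm{U}_\pi\text{ is a left singular subspace of }B\}$, and $\mathcal{L}_\pi^{\Bbbk}:\mathcal{U}_\pi\to\mathrm{Gr}(\sharp\pi,\Bbbk^p)$, $B\mapsto\mathrm{U}_\pi$. For $\rho\subset\{1,\ldots,q\}$ let $\mathrm{V}_\rho$ be the span of the columns of $V$ with index in $\rho$, $\mathcal{V}_\rho=\{B\in\Bbbk^{p\times q}\mid\mathrm{V}_\rho\text{ is a right singular subspace of }B\}$, and $\mathcal{R}_\rho^{\Bbbk}:\mathcal{V}_\rho\to\mathrm{Gr}(\sharp\rho,\Bbbk^q)$, $B\mapsto\mathrm{V}_\rho$. On these domains the subspaces do not depend on the choice of SVD. Distances: $\mathrm{Gr}(d,\Bbbk^p)$ is the Grassmannian of $d$-dimensional linear subspaces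 of $\Bbbk^p$, identified with the rank-$d$ orthogonal projectors $QQ^H$, $Q\in\Bbbk^{p\times d}$, $Q^HQ=I_d$. The principal angles between $P=QQ^H$ and $P'=Q'Q'^H$ are $\theta_i=\cos^{-1}(\sigma_i(Q^HQ'))$, $i=1,\ldots,d$; $\boldsymbol\theta=(\theta_1,\ldots,\theta_d)$. The chordal distance is $\|\sin\boldsymbol\theta\|=\frac1{\sqrt2}\|P-P'\|_F$, the Grassmann distance is $\|\boldsymbol\theta\|$, and the Procrustes distance is $\|2\sin(\boldsymbol\theta/2)\|$ (functions applied elementwise). The same choice of distance is made on both sides. Domains carry the Frobenius distance. *)

theory Defs
  imports
    Complex_Main
    "HOL-Library.Extended_Nonnegative_Real"
    "Jordan_Normal_Form.Schur_Decomposition"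
    "Jordan_Normal_Form.Matrix_Kernel"
    "Jordan_Normal_Form.DL_Rank"
begin

text \<open>
  The scalars are of sort \<open>{conjugatable_field, real_normed_field}\<close>, which has both \<open>real\<close>
  (with trivial conjugation) and \<open>complex\<close> as instances; \<open>mat_adjoint\<close> is the conjugate
  transpose.
\<close>

subsection \<open>Condition numbers\<close>

text \<open>
  The supremum is taken in \<open>[0, \<infinity>]\<close>, so it is \<open>0\<close> at isolated points. It is monotone in
  \<open>\<epsilon>\<close>, hence the limit always exists.
\<close>

definition cond_number ::
  "('x \<Rightarrow> 'x \<Rightarrow> real) \<Rightarrow> ('y \<Rightarrow> 'y \<Rightarrow> real) \<Rightarrow> 'x set \<Rightarrow> ('x \<Rightarrow> 'y) \<Rightarrow> 'x \<Rightarrow> ennreal" where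
  "cond_number dX dY X f x =
     Lim (at_right (0::real))
       (\<lambda>\<epsilon>. SUP x' \<in> {x' \<in> X. 0 < dX x x' \<and> dX x x' \<le> \<epsilon>}. ennreal (dY (f x) (f x') / dX x x'))"

definition frobenius_dist :: "'a::real_normed_field mat \<Rightarrow> 'a mat \<Rightarrow> real" where
  "frobenius_dist A B =
     sqrt (\<Sum>i<dim_row A. \<Sum>j<dim_col A. (norm (A $$ (i, j) - B $$ (i, j)))\<^sup>2)"

subsection \<open>Full singular value decompositions\<close>

definition unitary_mat :: "nat \<Rightarrow> 'a::conjugatable_field mat \<Rightarrow> bool" where
  "unitary_mat p U \<longleftrightarrow> U \<in> carrier_mat p p \<and> mat_adjoint U * U = 1\<^sub>m p"

definition svd_diag :: "nat \<Rightarrow> nat \<Rightarrow> real list \<Rightarrow> 'a::real_normed_field mat" where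
  "svd_diag p q \<sigma>s =
     mat p q (\<lambda>(i, j). if i = j \<and> i < length \<sigma>s then of_real (\<sigma>s ! i) else 0)"

text \<open>The list \<open>\<sigma>s\<close> consists of the nonzero singular values, with multiplicity.\<close>

definition full_svd ::
  "nat \<Rightarrow> nat \<Rightarrow> 'a::{conjugatable_field, real_normed_field} mat \<Rightarrow>
   'a mat \<Rightarrow> real list \<Rightarrow> 'a mat \<Rightarrow> bool" where
  "full_svd p q B U \<sigma>s V \<longleftrightarrow>
     B \<in> carrier_mat p q \<and> unitary_mat p U \<and> unitary_mat q V \<and>
     length \<sigma>s = vec_space.rank p B \<and> sorted_wrt (\<ge>) \<sigma>s \<and> (\<forall>\<sigma>\<in>set \<sigma>s. 0 < \<sigma>) \<and>
     B = U * svd_diag p q \<sigma>s * mat_adjoint V"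

definition nonzero_singular_values ::
  "nat \<Rightarrow> nat \<Rightarrow> 'a::{conjugatable_field, real_normed_field} mat \<Rightarrow> real set" where
  "nonzero_singular_values p q B = {\<sigma>. \<exists>U \<sigma>s V. full_svd p q B U \<sigma>s V \<and> \<sigma> \<in> set \<sigma>s}"

text \<open>
  All \<open>min p q\<close> singular values in decreasing order, including zeros; the singular values do not
  depend on the decomposition.
\<close>

definition singular_value_list ::
  "nat \<Rightarrow> nat \<Rightarrow> 'a::{conjugatable_field, real_normed_field} mat \<Rightarrow> real list" where
  "singular_value_list p q B =
     (THE xs. \<exists>U \<sigma>s V. full_svd p q B U \<sigma>s V \<and>
        xs = \<sigma>s @ replicate (min p q - length \<sigma>s) 0)"

subsection \<open>Singular subspaces\<close>

definition vec_span :: "nat \<Rightarrow> 'a::field vec set \<Rightarrow> 'a vec set" where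
  "vec_span p S = LinearCombinations.module.span class_ring (module_vec TYPE('a) p) S"

definition eigenspace :: "'a::field mat \<Rightarrow> 'a \<Rightarrow> 'a vec set" where
  "eigenspace A c = {x \<in> carrier_vec (dim_row A). A *\<^sub>v x = c \<cdot>\<^sub>v x}"

text \<open>
  For a nonzero singular value \<open>\<sigma>\<close>, the columns of \<open>U\<close> (respectively \<open>V\<close>) belonging to \<open>\<sigma>\<close> span
  the eigenspace of \<open>B * mat_adjoint B\<close> (respectively \<open>mat_adjoint B * B\<close>) for \<open>\<sigma>\<^sup>2\<close>.
  The value \<open>0\<close> gives the cokernel and the kernel, which may be trivial.
\<close>

definition left_singular_space ::
  "'a::{conjugatable_field, real_normed_field} mat \<Rightarrow> real \<Rightarrow> 'a vec set" where
  "left_singular_space B \<sigma> =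
     (if \<sigma> = 0 then mat_kernel (B * mat_adjoint B)
      else eigenspace (B * mat_adjoint B) (of_real (\<sigma>\<^sup>2)))"

definition right_singular_space ::
  "'a::{conjugatable_field, real_normed_field} mat \<Rightarrow> real \<Rightarrow> 'a vec set" where
  "right_singular_space B \<sigma> =
     (if \<sigma> = 0 then mat_kernel B
      else eigenspace (mat_adjoint B * B) (of_real (\<sigma>\<^sup>2)))"

text \<open>
  The spaces in the unions below are pairwise orthogonal (eigenspaces of a Hermitian matrix for
  distinct eigenvalues), so the sum of the spaces, the span of their union, is direct.
\<close>

definition is_left_singular_subspace ::
  "nat \<Rightarrow> nat \<Rightarrow> 'a::{conjugatable_field, real_normed_field} mat \<Rightarrow> 'a vec set \<Rightarrow> bool" where
  "is_left_singular_subspace p q B W \<longleftrightarrow>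
     (\<exists>S \<subseteq> insert 0 (nonzero_singular_values p q B).
        W = vec_span p (\<Union>\<sigma>\<in>S. left_singular_space B \<sigma>))"

definition is_right_singular_subspace ::
  "nat \<Rightarrow> nat \<Rightarrow> 'a::{conjugatable_field, real_normed_field} mat \<Rightarrow> 'a vec set \<Rightarrow> bool" where
  "is_right_singular_subspace p q B W \<longleftrightarrow>
     (\<exists>S \<subseteq> insert 0 (nonzero_singular_values p q B).
        W = vec_span q (\<Union>\<sigma>\<in>S. right_singular_space B \<sigma>))"

text \<open>Index sets are 1-based, the columns of a matrix are 0-based.\<close>

definition cols_span :: "nat \<Rightarrow> 'a::field mat \<Rightarrow> nat set \<Rightarrow> 'a vec set" where
  "cols_span p U \<pi> = vec_span p ((\<lambda>i. col U (i - 1)) ` \<pi>)"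

text \<open>
  If the selected columns span a singular subspace for one decomposition, then the index set is a
  union of complete blocks of equal singular values, so they span the same subspace for every other
  decomposition. Hence the existential quantifiers in the domains agree with universal ones, and the
  descriptions \<open>THE W\<close> are well defined on the domains.
\<close>

definition left_subspace_dom ::
  "nat \<Rightarrow> nat \<Rightarrow> nat set \<Rightarrow> 'a::{conjugatable_field, real_normed_field} mat set" where
  "left_subspace_dom p q \<pi> =
     {B \<in> carrier_mat p q. \<exists>U \<sigma>s V. full_svd p q B U \<sigma>s V \<and>
        is_left_singular_subspace p q B (cols_span p U \<pi>)}"

definition left_subspace_map ::
  "nat \<Rightarrow> nat \<Rightarrow> nat set \<Rightarrow> 'a::{conjugatable_field, real_normed_field} mat \<Rightarrow> 'a vec set" where
  "left_subspace_map p q \<pi> B =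
     (THE W. \<exists>U \<sigma>s V. full_svd p q B U \<sigma>s V \<and> W = cols_span p U \<pi>)"

definition right_subspace_dom ::
  "nat \<Rightarrow> nat \<Rightarrow> nat set \<Rightarrow> 'a::{conjugatable_field, real_normed_field} mat set" where
  "right_subspace_dom p q \<rho> =
     {B \<in> carrier_mat p q. \<exists>U \<sigma>s V. full_svd p q B U \<sigma>s V \<and>
        is_right_singular_subspace p q B (cols_span q V \<rho>)}"

definition right_subspace_map ::
  "nat \<Rightarrow> nat \<Rightarrow> nat set \<Rightarrow> 'a::{conjugatable_field, real_normed_field} mat \<Rightarrow> 'a vec set" where
  "right_subspace_map p q \<rho> B =
     (THE W. \<exists>U \<sigma>s V. full_svd p q B U \<sigma>s V \<and> W = cols_span q V \<rho>)"

subsection \<open>Distances on the Grassmannian\<close>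

definition orthonormal_basis_mat ::
  "nat \<Rightarrow> nat \<Rightarrow> 'a::conjugatable_field mat \<Rightarrow> 'a vec set \<Rightarrow> bool" where
  "orthonormal_basis_mat p d Q W \<longleftrightarrow>
     Q \<in> carrier_mat p d \<and> mat_adjoint Q * Q = 1\<^sub>m d \<and> vec_space.col_space p Q = W"

text \<open>
  Changing the orthonormal bases multiplies \<open>mat_adjoint Q * Q'\<close> by unitary matrices on both sides,
  so the angles depend only on the subspaces.
\<close>

definition principal_angles ::
  "nat \<Rightarrow> nat \<Rightarrow> 'a::{conjugatable_field, real_normed_field} vec set \<Rightarrow> 'a vec set \<Rightarrow> real list" where
  "principal_angles p d W W' =
     (THE \<theta>. \<exists>Q Q'. orthonormal_basis_mat p d Q W \<and> orthonormal_basis_mat p d Q' W' \<and>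
        \<theta> = map arccos (singular_value_list d d (mat_adjoint Q * Q')))"

datatype gr_distance = Chordal | Grassmann | Procrustes

fun angle_fun :: "gr_distance \<Rightarrow> real \<Rightarrow> real" where
  "angle_fun Chordal t = sin t"
| "angle_fun Grassmann t = t"
| "angle_fun Procrustes t = 2 * sin (t / 2)"

definition gr_dist ::
  "gr_distance \<Rightarrow> nat \<Rightarrow> nat \<Rightarrow>
   'a::{conjugatable_field, real_normed_field} vec set \<Rightarrow> 'a vec set \<Rightarrow> real" where
  "gr_dist \<delta> p d W W' = sqrt (\<Sum>t\<leftarrow>principal_angles p d W W'. (angle_fun \<delta> t)\<^sup>2)"

end

theory Submission
  imports Defs
begin

text \<open>
  If \<open>B = U \<Sigma> V\<^sup>H\<close> is a singular value decomposition, then so is \<open>B\<^sup>H = V \<Sigma>\<^sup>H U\<^sup>H\<close>: taking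
  adjoints exchanges the left and the right singular vectors and keeps the singular values
  (\<open>full_svd_adjoint\<close>). Therefore \<open>B \<mapsto> B\<^sup>H\<close> maps the domain of the right subspace map onto the
  domain of the left one and carries the first map to the second
  (\<open>left_subspace_dom_eq_adjoint_image\<close>, \<open>left_subspace_map_adjoint\<close>). It is also an isometry for
  the Frobenius distance, and a condition number is unchanged when the domain is replaced by an
  isometric copy (\<open>cond_number_isometry\<close>); the distances in the target agree because the two
  maps take the same values, not merely isometric ones.

  Two points need more than rewriting. A decomposition lists exactly as many singular values as
  the rank of the matrix, so exchanging sides requires that \<open>B\<close> and \<open>B\<^sup>H\<close> have the same rank
  (\<open>rank_mat_adjoint\<close>). For the singular value \<open>0\<close>, the right singular space of \<open>B\<close> is the kernel
  of \<open>B\<close>, whereas the left singular space of \<open>B\<^sup>H\<close> is the kernel of \<open>B\<^sup>H B\<close>; these agree because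
  the inner product is definite (\<open>mat_kernel_adjoint_mult\<close>).
\<close>

section \<open>The conjugate transpose\<close>

text \<open>
  The common ground of the real and the complex case: conjugation is real linear, so it fixes the
  real singular values, and isometric, so taking adjoints preserves Frobenius distances.
\<close>

class conjugate_normed_field = conjugatable_ordered_field + real_normed_field +
  assumes conjugate_scaleR: "conjugate (scaleR r x) = scaleR r (conjugate x)"
    and norm_conjugate: "norm (conjugate x) = norm x"

instance real :: conjugate_normed_field
  by standard simp_all

instance complex :: conjugate_normed_field
  by standard simp_all

lemma conjugate_of_real: "conjugate (of_real r :: 'a::conjugate_normed_field) = of_real r"
proof -
  have "conjugate (1::'a) * conjugate 1 = conjugate 1"
    by (simp flip: conjugate_dist_mul)
  then have "conjugate (1::'a) = 1"
    by simp
  then show ?thesis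
    by (simp add: of_real_def conjugate_scaleR)
qed

lemma dim_mat_adjoint [simp]:
  "dim_row (mat_adjoint A) = dim_col A" "dim_col (mat_adjoint A) = dim_row A"
  by (simp_all add: mat_adjoint_def)

lemma mat_adjoint_carrier [simp]:
  "mat_adjoint A \<in> carrier_mat m n \<longleftrightarrow> A \<in> carrier_mat n m"
  by (metis carrier_matD carrier_matI dim_mat_adjoint)

lemma index_mat_adjoint [simp]:
  "i < dim_col A \<Longrightarrow> j < dim_row A \<Longrightarrow> mat_adjoint A $$ (i, j) = conjugate (A $$ (j, i))"
  by (simp add: mat_adjoint_def mat_of_rows_index)

lemma mat_adjoint_adjoint [simp]: "mat_adjoint (mat_adjoint A) = A"
  by (rule eq_matI) simp_all

lemma mat_adjoint_mult:
  assumes "dim_col A = dim_row B"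
  shows "mat_adjoint (A * B) = mat_adjoint B * mat_adjoint A"
proof (rule eq_matI)
  fix i j
  assume "i < dim_row (mat_adjoint B * mat_adjoint A)"
    and "j < dim_col (mat_adjoint B * mat_adjoint A)"
  then have ij: "i < dim_col B" "j < dim_row A"
    by simp_all
  have "mat_adjoint (A * B) $$ (i, j) = (\<Sum>k<dim_row B. conjugate (A $$ (j, k) * B $$ (k, i)))"
    using ij assms by (simp add: scalar_prod_def sum_conjugate lessThan_atLeast0)
  also have "\<dots> = (mat_adjoint B * mat_adjoint A) $$ (i, j)"
    using ij assms by (simp add: scalar_prod_def conjugate_dist_mul mult.commute lessThan_atLeast0)
  finally show "mat_adjoint (A * B) $$ (i, j) = (mat_adjoint B * mat_adjoint A) $$ (i, j)" .
qed simp_all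

text \<open>
  If \<open>A\<^sup>H A x = 0\<close>, then \<open>y = A x\<close> satisfies \<open>\<langle>y, y\<rangle> = \<langle>x, A\<^sup>H y\<rangle> = 0\<close> and hence vanishes.
\<close>

lemma mat_kernel_adjoint_mult:
  fixes A :: "'a::conjugatable_ordered_field mat"
  shows "mat_kernel (mat_adjoint A * A) = mat_kernel A"
proof (intro equalityI subsetI)
  fix x assume "x \<in> mat_kernel (mat_adjoint A * A)"
  then have x: "x \<in> carrier_vec (dim_col A)" and kernel: "(mat_adjoint A * A) *\<^sub>v x = 0\<^sub>v (dim_col A)"
    by (auto simp: mat_kernel_def)
  define y where "y = A *\<^sub>v x"
  have y: "y \<in> carrier_vec (dim_row A)"
    by (auto simp: y_def intro: carrier_vecI)
  have "mat_adjoint A *\<^sub>v y = (mat_adjoint A * A) *\<^sub>v x"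
    unfolding y_def using x
    by (intro assoc_mult_mat_vec[symmetric, of _ "dim_col A" "dim_row A" _ "dim_col A"]) simp_all
  then have adj_y: "mat_adjoint A *\<^sub>v y = 0\<^sub>v (dim_col A)"
    using kernel by simp
  have "y \<bullet>c y = (\<Sum>i<dim_row A. (\<Sum>j<dim_col A. A $$ (i, j) * x $ j) * conjugate (y $ i))"
    using x y unfolding scalar_prod_def
    by (auto simp: y_def scalar_prod_def lessThan_atLeast0 intro!: sum.cong)
  also have "\<dots> = (\<Sum>j<dim_col A. x $ j * (\<Sum>i<dim_row A. A $$ (i, j) * conjugate (y $ i)))"
    by (simp add: sum_distrib_left sum_distrib_right mult_ac)
       (rule sum.swap)
  also have "\<dots> = (\<Sum>j<dim_col A. x $ j * conjugate ((mat_adjoint A *\<^sub>v y) $ j))"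
    using y by (intro sum.cong)
      (auto simp: scalar_prod_def sum_conjugate conjugate_dist_mul lessThan_atLeast0)
  also have "\<dots> = 0"
    by (simp add: adj_y)
  finally have "y = 0\<^sub>v (dim_row A)"
    using y conjugate_square_eq_0_vec by blast
  then show "x \<in> mat_kernel A"
    using x by (simp add: mat_kernel_def y_def)
next
  fix x assume "x \<in> mat_kernel A"
  then show "x \<in> mat_kernel (mat_adjoint A * A)"
    using mat_kernel_mult_subset[of A "dim_row A" "dim_col A" "mat_adjoint A" "dim_col A"]
    by auto
qed

section \<open>The rank of the conjugate transpose\<close>

lemma (in vec_space) rank_mult_le_rank_left:
  assumes A: "A \<in> carrier_mat n r" and B: "B \<in> carrier_mat r m"
  shows "rank (A * B) \<le> rank A"
proof -
  have AB: "A * B \<in> carrier_mat n m"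
    using A B by simp
  have cols_A: "set (cols A) \<subseteq> carrier_vec n" and cols_AB: "set (cols (A * B)) \<subseteq> carrier_vec n"
    using A AB cols_dim[of A] cols_dim[of "A * B"] by simp_all
  have "col_space (A * B) \<subseteq> col_space A"
  proof
    fix y assume "y \<in> col_space (A * B)"
    then obtain x where "x \<in> carrier_vec m" "(A * B) *\<^sub>v x = y"
      using AB B by (auto simp: col_space_eq[OF AB])
    then have "A *\<^sub>v (B *\<^sub>v x) = y" "B *\<^sub>v x \<in> carrier_vec r"
      using A B by auto
    then show "y \<in> col_space A"
      using A by (auto simp: col_space_eq[OF A])
  qed
  then have le: "span (set (cols (A * B))) \<subseteq> span (set (cols A))"
    by (simp add: col_space_def)
  have sub: "VectorSpace.subspace class_ring (span (set (cols A))) V"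
    "VectorSpace.subspace class_ring (span (set (cols (A * B)))) V"
    using cols_A cols_AB span_is_subspace by auto
  have vs: "vectorspace class_ring (span_vs (set (cols A)))"
    using sub(1) subspace_is_vs by blast
  show ?thesis
    using vectorspace.subspace_dim[OF vs nested_subspaces[OF sub le]]
      fin_dim_span_cols[OF A] fin_dim_span_cols[OF AB]
    by (simp add: rank_def)
qed

text \<open>
  Take for \<open>C\<close> a maximal independent set of columns of \<open>A\<close>, and for \<open>X\<close> the coordinates of all
  columns of \<open>A\<close> with respect to it. The inner dimension of the factorization survives taking
  adjoints, which is why it gives control over the rank of the adjoint.
\<close>

lemma (in vec_space) rank_factorization:
  assumes A: "A \<in> carrier_mat n m"
  obtains C X where "C \<in> carrier_mat n (rank A)" "X \<in> carrier_mat (rank A) m" "A = C * X"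
proof -
  have cols_A: "set (cols A) \<subseteq> carrier_vec n"
    using A cols_dim[of A] by simp
  obtain S where S: "finite S" "maximal S (\<lambda>T. T \<subseteq> set (cols A) \<and> lin_indpt T)"
    using maximal_exists_superset[of "set (cols A)" "\<lambda>T. T \<subseteq> set (cols A) \<and> lin_indpt T" "{}"]
    by (auto simp: finite_lin_indpt2)
  then have S_sub: "S \<subseteq> set (cols A)" and S_indpt: "lin_indpt S"
    by (auto simp: maximal_def)
  have S_carrier: "S \<subseteq> carrier_vec n"
    using S_sub cols_A by simp
  obtain ss where ss: "set ss = S" "distinct ss"
    using finite_distinct_list[OF \<open>finite S\<close>] by blast
  have len: "length ss = rank A"
    using rank_card_indpt[OF A S(2)] distinct_card[OF ss(2)] ss(1) by simp
  define C where "C = mat_of_cols n ss"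
  have C: "C \<in> carrier_mat n (rank A)" and cols_C: "cols C = ss"
    using S_sub cols_A ss by (auto simp: C_def len)
  have "\<exists>x \<in> carrier_vec (rank A). C *\<^sub>v x = col A j" if "j < m" for j
  proof -
    have col: "col A j \<in> set (cols A)"
      using A that by (metis carrier_matD(2) cols_length cols_nth nth_mem)
    have "col A j \<in> span S"
    proof (cases "col A j \<in> S")
      case True
      then show ?thesis
        by (intro span_mem[OF S_carrier])
    next
      case False
      have "lin_dep (S \<union> {col A j})"
      proof (rule ccontr)
        assume "lin_indpt (S \<union> {col A j})"
        then have "S \<union> {col A j} = S"
          using S(2)[unfolded maximal_def, THEN conjunct2, rule_format, of "S \<union> {col A j}"] S_sub col
          by auto
        then show False
          using False by blast
      qed
      then show ?thesis
        using lin_dep_iff_in_span[of S "col A j"] S_carrier S_indpt False subsetD[OF cols_A col] by simp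
    qed
    then have "col A j \<in> col_space C"
      by (simp add: col_space_def cols_C ss)
    then show ?thesis
      using C by (auto simp: col_space_eq[OF C])
  qed
  then obtain x where x: "\<And>j. j < m \<Longrightarrow> x j \<in> carrier_vec (rank A)"
    "\<And>j. j < m \<Longrightarrow> C *\<^sub>v x j = col A j"
    by metis
  define X where "X = mat (rank A) m (\<lambda>(i, j). x j $ i)"
  have X: "X \<in> carrier_mat (rank A) m"
    by (simp add: X_def)
  have col_X: "col X j = x j" if "j < m" for j
    using x(1)[OF that] that by (auto simp: X_def)
  have "col A j = col (C * X) j" if "j < m" for j
    using that by (simp add: col_mult2[OF C X that] col_X x(2))
  then have "A = C * X"
    using A C X by (intro mat_col_eqI) simp_all
  then show thesis
    using that C X by blast
qed

text \<open>
  With \<open>A = C X\<close> of inner dimension \<open>r = rank A\<close>, the adjoint is \<open>X\<^sup>H C\<^sup>H\<close>, and \<open>X\<^sup>H\<close> has only \<open>r\<close>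
  columns; so the rank cannot grow under taking adjoints, and doing so twice gives equality.
\<close>

lemma rank_mat_adjoint:
  assumes "A \<in> carrier_mat n m"
  shows "vec_space.rank m (mat_adjoint A) = vec_space.rank n A"
proof -
  have le: "vec_space.rank m (mat_adjoint A) \<le> vec_space.rank n A"
    if A: "A \<in> carrier_mat n m" for A :: "'a mat" and n m
  proof -
    obtain C X where "C \<in> carrier_mat n (vec_space.rank n A)"
      "X \<in> carrier_mat (vec_space.rank n A) m" "A = C * X"
      using vec_space.rank_factorization[OF A] .
    then show ?thesis
      using vec_space.rank_mult_le_rank_left
          [of "mat_adjoint X" m "vec_space.rank n A" "mat_adjoint C" n]
        vec_space.rank_le_nc[of "mat_adjoint X" m "vec_space.rank n A"]
      by (simp add: mat_adjoint_mult)
  qed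
  show ?thesis
    using le[of A n m] le[of "mat_adjoint A" m n] assms by simp
qed

section \<open>Singular value decompositions and singular subspaces\<close>

lemma mat_adjoint_svd_diag:
  "mat_adjoint (svd_diag p q \<sigma>s :: 'a::conjugate_normed_field mat) = svd_diag q p \<sigma>s"
  by (rule eq_matI) (auto simp: svd_diag_def conjugate_of_real)

lemma full_svd_adjoint:
  fixes B :: "'a::conjugate_normed_field mat"
  assumes "full_svd p q B U \<sigma>s V"
  shows "full_svd q p (mat_adjoint B) V \<sigma>s U"
proof -
  have B: "B \<in> carrier_mat p q" and U: "U \<in> carrier_mat p p" and V: "V \<in> carrier_mat q q"
    and eq: "B = U * svd_diag p q \<sigma>s * mat_adjoint V"
    using assms by (auto simp: full_svd_def unitary_mat_def)
  have S: "(svd_diag p q \<sigma>s :: 'a mat) \<in> carrier_mat p q" for p q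
    by (simp add: svd_diag_def)
  have "mat_adjoint B = V * (svd_diag q p \<sigma>s * mat_adjoint U)"
    using U V carrier_matD[OF S[of p q]] by (simp add: eq mat_adjoint_mult mat_adjoint_svd_diag)
  also have "\<dots> = V * svd_diag q p \<sigma>s * mat_adjoint U"
    using assoc_mult_mat[OF V S[of q p], of "mat_adjoint U" p] U by simp
  finally have "mat_adjoint B = V * svd_diag q p \<sigma>s * mat_adjoint U" .
  moreover have "mat_adjoint B \<in> carrier_mat q p"
    "vec_space.rank q (mat_adjoint B) = vec_space.rank p B"
    using B by (simp_all add: rank_mat_adjoint)
  ultimately show ?thesis
    using assms by (metis full_svd_def)
qed

lemma full_svd_adjoint_iff:
  fixes B :: "'a::conjugate_normed_field mat"
  shows "full_svd q p (mat_adjoint B) V \<sigma>s U \<longleftrightarrow> full_svd p q B U \<sigma>s V"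
  using full_svd_adjoint[of p q B U \<sigma>s V] full_svd_adjoint[of q p "mat_adjoint B" V \<sigma>s U] by auto

text \<open>
  The form in which the domains and the subspace maps refer to decompositions: both depend only on
  the unitary factor that contributes the columns.
\<close>

lemma ex_full_svd_adjoint_iff:
  fixes B :: "'a::conjugate_normed_field mat"
  shows "(\<exists>V \<sigma>s U. full_svd q p (mat_adjoint B) V \<sigma>s U \<and> P V) \<longleftrightarrow>
    (\<exists>U \<sigma>s V. full_svd p q B U \<sigma>s V \<and> P V)"
  unfolding full_svd_adjoint_iff by blast

lemma nonzero_singular_values_adjoint:
  fixes B :: "'a::conjugate_normed_field mat"
  shows "nonzero_singular_values q p (mat_adjoint B) = nonzero_singular_values p q B"
  by (auto simp: nonzero_singular_values_def full_svd_adjoint_iff)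

lemma left_singular_space_adjoint:
  fixes B :: "'a::conjugate_normed_field mat"
  shows "left_singular_space (mat_adjoint B) \<sigma> = right_singular_space B \<sigma>"
  by (simp add: left_singular_space_def right_singular_space_def mat_kernel_adjoint_mult)

lemma is_left_singular_subspace_adjoint:
  fixes B :: "'a::conjugate_normed_field mat"
  shows "is_left_singular_subspace q p (mat_adjoint B) W \<longleftrightarrow> is_right_singular_subspace p q B W"
  by (simp add: is_left_singular_subspace_def is_right_singular_subspace_def
      nonzero_singular_values_adjoint left_singular_space_adjoint)

lemma mat_adjoint_in_left_subspace_dom_iff:
  fixes B :: "'a::conjugate_normed_field mat"
  shows "mat_adjoint B \<in> left_subspace_dom q p \<rho> \<longleftrightarrow> B \<in> right_subspace_dom p q \<rho>"
  unfolding left_subspace_dom_def right_subspace_dom_def mem_Collect_eq ex_full_svd_adjoint_iff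
    is_left_singular_subspace_adjoint mat_adjoint_carrier ..

lemma left_subspace_dom_eq_adjoint_image:
  "left_subspace_dom q p \<rho> =
     (mat_adjoint ` right_subspace_dom p q \<rho> :: 'a::conjugate_normed_field mat set)"
proof (intro equalityI subsetI)
  fix C :: "'a mat" assume "C \<in> left_subspace_dom q p \<rho>"
  then have "mat_adjoint C \<in> right_subspace_dom p q \<rho>"
    by (simp flip: mat_adjoint_in_left_subspace_dom_iff)
  then show "C \<in> mat_adjoint ` right_subspace_dom p q \<rho>"
    by (metis imageI mat_adjoint_adjoint)
qed (auto simp: mat_adjoint_in_left_subspace_dom_iff)

lemma left_subspace_map_adjoint:
  fixes B :: "'a::conjugate_normed_field mat"
  shows "left_subspace_map q p \<rho> (mat_adjoint B) = right_subspace_map p q \<rho> B"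
  unfolding left_subspace_map_def right_subspace_map_def ex_full_svd_adjoint_iff ..

section \<open>Condition numbers under isometries\<close>

lemma frobenius_dist_adjoint:
  fixes A B :: "'a::conjugate_normed_field mat"
  assumes "A \<in> carrier_mat p q" "B \<in> carrier_mat p q"
  shows "frobenius_dist (mat_adjoint A) (mat_adjoint B) = frobenius_dist A B"
proof -
  have "norm (conjugate a - conjugate b) = norm (a - b)" for a b :: 'a
    using norm_conjugate[of "a - b"] conjugate_dist_add[of a "- b"] by (simp add: conjugate_neg)
  then show ?thesis
    using assms by (simp add: frobenius_dist_def) (rule sum.swap)
qed

text \<open>
  The isometry identifies, for every \<open>\<epsilon>\<close>, the two index sets of the supremum together with the
  difference quotients, so the functions of \<open>\<epsilon>\<close> whose limits are compared already coincide.
\<close>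

lemma cond_number_isometry:
  assumes iso: "\<And>x x'. x \<in> X \<Longrightarrow> x' \<in> X \<Longrightarrow> dX' (g x) (g x') = dX x x'"
    and f: "\<And>x. x \<in> X \<Longrightarrow> f' (g x) = f x" and x: "x \<in> X"
  shows "cond_number dX' dY (g ` X) f' (g x) = cond_number dX dY X f x"
proof -
  have "{y \<in> g ` X. 0 < dX' (g x) y \<and> dX' (g x) y \<le> \<epsilon>} =
      g ` {x' \<in> X. 0 < dX x x' \<and> dX x x' \<le> \<epsilon>}" for \<epsilon>
    using iso x by auto
  then show ?thesis
    unfolding cond_number_def by (simp add: image_image iso f x cong: image_cong_simp)
qed

lemma cond_number_right_eq_left_adjoint:
  fixes A :: "'a::conjugate_normed_field mat"
  assumes "A \<in> right_subspace_dom m n \<rho>"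
  shows "cond_number frobenius_dist d (right_subspace_dom m n \<rho>) (right_subspace_map m n \<rho>) A
    = cond_number frobenius_dist d (left_subspace_dom n m \<rho>) (left_subspace_map n m \<rho>)
        (mat_adjoint A)"
  unfolding left_subspace_dom_eq_adjoint_image
  using assms
  by (intro cond_number_isometry[symmetric])
     (auto simp: left_subspace_map_adjoint right_subspace_dom_def intro: frobenius_dist_adjoint)

theorem lemma1:
  fixes m n l :: nat and \<rho> :: "nat set" and \<delta> :: gr_distance
  assumes "\<rho> \<subseteq> {1..n}" and "card \<rho> = l"
  shows
    "(\<forall>A :: real mat. A \<in> right_subspace_dom m n \<rho> \<longrightarrow>
        mat_adjoint A \<in> left_subspace_dom n m \<rho> \<and>
        cond_number frobenius_dist (gr_dist \<delta> n l)
          (right_subspace_dom m n \<rho>) (right_subspace_map m n \<rho>) A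
        = cond_number frobenius_dist (gr_dist \<delta> n l)
            (left_subspace_dom n m \<rho>) (left_subspace_map n m \<rho>) (mat_adjoint A)) \<and>
     (\<forall>A :: complex mat. A \<in> right_subspace_dom m n \<rho> \<longrightarrow>
        mat_adjoint A \<in> left_subspace_dom n m \<rho> \<and>
        cond_number frobenius_dist (gr_dist \<delta> n l)
          (right_subspace_dom m n \<rho>) (right_subspace_map m n \<rho>) A
        = cond_number frobenius_dist (gr_dist \<delta> n l)
            (left_subspace_dom n m \<rho>) (left_subspace_map n m \<rho>) (mat_adjoint A))"
  by (simp add: mat_adjoint_in_left_subspace_dom_iff cond_number_right_eq_left_adjoint)

end
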